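(* Let $(r_n)_{n\in\mathbb{N}}$ be deterministic radii with $0\le r_n<1$ and $\sum_n(1-r_n)<\infty$, let $(\theta_n)_{n\in\mathbb{N}}$ be independent random variables uniformly distributed in $[0,2\pi)$, and let $\Lambda=\Lambda(\omega)=(r_ne^{i\theta_n(\omega)})_{n\in\mathbb{N}}$. Then $$\mathbb{P}\big(\Lambda\text{ is interpolating for }\mathcal{N}\text{ in the sense of Naftalevič}\big)=0.$$
   Context: $\mathbb{D}=\{z\in\mathbb{C}:|z|<1\}$, and $\mathrm{Hol}(\mathbb{D})$ is the set of holomorphic functions on $\mathbb{D}$. The Nevanlinna class is $$\mathcal{N}=\Big\{f\in\mathrm{Hol}(\mathbb{D}):\lim_{r\to1}\frac1{2\pi}\int_0^{2\pi}\log^+|f(re^{i\theta})|\,d\theta<\infty\Big\}.$$ For a sequence $\Lambda=(\lambda)_{\lambda\in\Lambda}$ in $\mathbb{D}$, the trace space is $\mathcal{N}|_\Lambda=\{(f(\lambda))_{\lambda\in\Lambda}:f\in\mathcal{N}\}$. The sequence $\Lambda$ is interpolating for $\mathcal{N}$ in the sense of Naftalevič if $$\mathcal{N}|_\Lambda=\Big\{(a_\lambda)_{\lambda\in\Lambda}:\ \sup_{\lambda\in\Lambda}(1-|\lambda|)\log^+|a_\lambda|<\infty\Big\}.$$ Known theorem of Naftalevič: this holds if and only if $\Lambda$ is contained in a finite union of Stolz angles and $\sup_{\lambda\in\Lambda}(1-|\lambda|)\log\frac1{|B_\lambda(\lambda)|}<\infty$. Here a Stolz angle is a set $\Gamma_\alpha(\zeta)=\{z\in\mathbb{D}:|\zeta-z|\le\alpha(1-|z|)\}$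 with $|\zeta|=1$ and $\alpha>1$, and $|B_\lambda(\lambda)|=\prod_{\mu\in\Lambda,\,\mu\ne\lambda}\left|\frac{\lambda-\mu}{1-\overline{\mu}\lambda}\right|$. *)

theory Defs
  imports "HOL-Probability.Probability" "HOL-Complex_Analysis.Complex_Analysis"
begin

(* log^+ 0 = 0 as usual, since ln 0 = 0. *)
definition log_plus :: "real \<Rightarrow> real" where
  "log_plus x = max 0 (ln x)"

(* Functions are total; only their values on the unit disc matter.  The existence of a real limit
   expresses that the (always existing) limit in [0, \<infinity>] is finite. *)
definition nevanlinna :: "(complex \<Rightarrow> complex) set" where
  "nevanlinna = {f. f holomorphic_on ball 0 1 \<and>
     (\<exists>L::real. ((\<lambda>r. 1 / (2 * pi) *
        integral {0..2 * pi} (\<lambda>t. log_plus (cmod (f (of_real r * cis t))))) \<longlongrightarrow> L) (at_left 1))}"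

(* A family (a_\<lambda>) indexed by the points \<lambda> of \<Lambda> is a function in extensional \<Lambda>. *)
definition nevanlinna_trace :: "complex set \<Rightarrow> (complex \<Rightarrow> complex) set" where
  "nevanlinna_trace \<Lambda> = (\<lambda>f. restrict f \<Lambda>) ` nevanlinna"

definition naftalevic_interpolating :: "complex set \<Rightarrow> bool" where
  "naftalevic_interpolating \<Lambda> \<longleftrightarrow>
     nevanlinna_trace \<Lambda> =
       {a \<in> extensional \<Lambda>. bdd_above ((\<lambda>z. (1 - cmod z) * log_plus (cmod (a z))) ` \<Lambda>)}"

end

theory Submission
  imports Defs
begin

text \<open>
  The independent uniform arguments almost surely make every point of the unit circle a limit point
  of \<open>\<Lambda>\<close>. If \<open>\<Lambda>\<close> were interpolating, some \<open>f\<close> in the Nevanlinna class would take the values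
  \<open>exp (1 / (1 - |\<lambda>|))\<close> on \<open>\<Lambda>\<close>. Choose \<open>\<lambda>\<^sub>1, \<dots>, \<lambda>\<^sub>K\<close> in \<open>\<Lambda>\<close> very close to \<open>K\<close> distinct points of the
  circle. The weighted Poisson kernels \<open>(1 - |\<lambda>\<^sub>j|) P(\<lambda>\<^sub>j, \<cdot>)\<close> are bounded by 2 and essentially live on
  disjoint arcs, so their sum is at most 4, and the Poisson majorant of \<open>log\<^sup>+ |f|\<close> yields
  \<open>K = \<Sum>\<^sub>j (1 - |\<lambda>\<^sub>j|) log\<^sup>+ |f(\<lambda>\<^sub>j)| \<le> C\<close> with \<open>C\<close> depending only on the Nevanlinna mean of \<open>f\<close>.
  This fails for large \<open>K\<close>. No use is made of Naftalevic's theorem.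
\<close>

section \<open>Poisson kernel and Poisson integrals of entire functions\<close>

definition poisson_kernel :: "complex \<Rightarrow> complex \<Rightarrow> real" where
  "poisson_kernel z w = (1 - (cmod z)\<^sup>2) / (cmod (w - z))\<^sup>2"

lemma poisson_kernel_nonneg: "cmod z < 1 \<Longrightarrow> poisson_kernel z w \<ge> 0"
  by (simp add: poisson_kernel_def power_le_one)

text \<open>On the circle \<open>1 - cnj z * w = w * cnj (w - z)\<close>, which turns the kernel
  into a Cauchy kernel plus a term holomorphic in \<open>w\<close> on the closed disc. This form
  makes Cauchy's formula and theorem applicable.\<close>

lemma poisson_kernel_eq:
  assumes "cmod z < 1" "cmod w = 1"
  shows "of_real (poisson_kernel z w) = w / (w - z) + cnj z * w / (1 - cnj z * w)"
proof -
  have w: "w * cnj w = 1"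
    using assms complex_norm_square[of w] by simp
  have nz: "w - z \<noteq> 0"
    using assms by auto
  have "1 - cnj z * w = w * cnj (w - z)"
    using w by (simp add: algebra_simps)
  moreover have "w \<noteq> 0" using assms by auto
  ultimately have "w / (w - z) + cnj z * w / (1 - cnj z * w) = w / (w - z) + cnj z / cnj (w - z)"
    by simp
  also have "\<dots> = (w * cnj (w - z) + cnj z * (w - z)) / ((w - z) * cnj (w - z))"
    using nz by (simp add: divide_simps flip: complex_cnj_diff)
  also have "w * cnj (w - z) + cnj z * (w - z) = 1 - z * cnj z"
    using w by (simp add: algebra_simps)
  also have "(w - z) * cnj (w - z) = of_real ((cmod (w - z))\<^sup>2)"
    by (simp only: complex_norm_square)
  also have "1 - z * cnj z = of_real (1 - (cmod z)\<^sup>2)"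
    by (simp only: complex_norm_square of_real_diff of_real_1)
  finally show ?thesis
    by (simp add: poisson_kernel_def)
qed

lemma continuous_on_poisson_kernel:
  assumes "cmod z < 1"
  shows "continuous_on A (\<lambda>t. poisson_kernel z (cis t))"
proof -
  have "cis t \<noteq> z" for t using assms norm_cis[of t] by auto
  then show ?thesis
    unfolding poisson_kernel_def by (intro continuous_intros) auto
qed

text \<open>In the splitting of \<open>poisson_kernel_eq\<close>, Cauchy's formula evaluates the
  first summand and Cauchy's theorem kills the second. The kernel is not normalized; the case
  \<open>f = 1\<close> gives its total mass \<open>2 * pi\<close>.\<close>

lemma poisson_integral_holomorphic:
  fixes f :: "complex \<Rightarrow> complex"
  assumes f: "f holomorphic_on UNIV" and z: "cmod z < 1"
  shows "((\<lambda>t. of_real (poisson_kernel z (cis t)) * f (cis t)) has_integral 2 * pi * f z) {0..2 * pi}"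
proof -
  have c: "continuous_on A f" for A
    using f holomorphic_on_imp_continuous_on continuous_on_subset by blast
  \<comment> \<open>The pole \<open>1 / cnj z\<close> is the reflection of \<open>z\<close> in the
    circle, hence lies outside the closed disc.\<close>
  have nz: "1 - cnj z * w \<noteq> 0" if "cmod w \<le> 1" for w
  proof
    assume "1 - cnj z * w = 0"
    then have "cmod (cnj z * w) = 1" by (metis eq_iff_diff_eq_0 norm_one)
    moreover have "cmod z * cmod w \<le> cmod z * 1"
      using that by (intro mult_left_mono) auto
    ultimately show False using z by (simp add: norm_mult)
  qed
  have 1: "((\<lambda>u. f u/(u-z)) has_contour_integral (2 * of_real pi * \<i> * f z)) (circlepath 0 1)"
    using z by (intro Cauchy_integral_circlepath c holomorphic_on_subset[OF f]) auto
  have 2: "((\<lambda>u. f u * cnj z / (1 - cnj z * u)) has_contour_integral 0) (circlepath 0 1)"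
    by (rule Cauchy_theorem_convex_simple[where S = "cball 0 1"])
      (use nz in \<open>auto intro!: holomorphic_intros holomorphic_on_subset[OF f]\<close>)
  from has_contour_integral_add[OF 1 2] 
  have "((\<lambda>t. (f (cis t) / (cis t - z) + f (cis t) * cnj z / (1 - cnj z * cis t)) * \<i> * cis t)
     has_integral 2 * of_real pi * \<i> * f z) {0..2*pi}"
    unfolding circlepath_def by (subst (asm) has_contour_integral_part_circlepath_iff) auto
  from has_integral_mult_right[OF this, of "-\<i>"]
  have "((\<lambda>t. -\<i> * ((f (cis t) / (cis t - z) + f (cis t) * cnj z / (1 - cnj z * cis t)) * \<i> * cis t))
     has_integral 2 * pi * f z) {0..2*pi}"
    by (simp add: algebra_simps)
  then show ?thesis
  proof (rule has_integral_eq[rotated])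
    fix t :: real
    have "of_real (poisson_kernel z (cis t)) * f (cis t) =
      (cis t / (cis t - z) + cnj z * cis t / (1 - cnj z * cis t)) * f (cis t)"
      by (subst poisson_kernel_eq) (use z in auto)
    also have "\<dots> = -\<i> * ((f (cis t) / (cis t - z) + f (cis t) * cnj z / (1 - cnj z * cis t)) * \<i> * cis t)"
      by (simp add: algebra_simps add_divide_distrib)
    finally show "-\<i> * ((f (cis t) / (cis t - z) + f (cis t) * cnj z / (1 - cnj z * cis t)) * \<i> * cis t)
       = of_real (poisson_kernel z (cis t)) * f (cis t)" ..
  qed
qed

section \<open>Real parts of polynomials on the unit circle\<close>

text \<open>
  On the unit circle the real parts of polynomials form an algebra, because there
  \<open>cnj z * z = 1\<close> removes the mixed terms. Hence Stone--Weierstrass applies to them.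
\<close>

lemma Re_poly_mult_cnj_poly:
  "\<exists>r. \<forall>z. cmod z = 1 \<longrightarrow> Re (poly p z * cnj (poly q z)) = Re (poly r z)"
proof (induction p arbitrary: q rule: pCons_induct)
  case 0
  show ?case by (intro exI[of _ 0]) auto
next
  case (pCons a p)
  obtain b q' where q: "q = pCons b q'" by (cases q)
  from pCons.IH obtain r where r: "\<And>z. cmod z = 1 \<Longrightarrow> Re (poly p z * cnj (poly q' z)) = Re (poly r z)"
    by blast
  show ?case
  proof (intro exI[of _ "r + pCons (a * cnj b) (smult (cnj a) q' + smult (cnj b) p)"] allI impI)
    fix z :: complex assume z: "cmod z = 1"
    then have zz: "z * cnj z = 1"
      using complex_norm_square[of z] by simp
    have "poly (pCons a p) z * cnj (poly q z) =
       a * cnj b + cnj (cnj a * (z * poly q' z)) + cnj b * (z * poly p z) + (z * cnj z) * (poly p z * cnj (poly q' z))"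
      unfolding q by (simp add: algebra_simps)
    then show "Re (poly (pCons a p) z * cnj (poly q z)) =
       Re (poly (r + pCons (a * cnj b) (smult (cnj a) q' + smult (cnj b) p)) z)"
      using r[OF z] zz by (simp add: algebra_simps)
  qed
qed

lemma real_polynomial_function_unit_circle:
  assumes "real_polynomial_function g"
  shows "\<exists>p. \<forall>z. cmod z = 1 \<longrightarrow> g z = Re (poly p z)"
  using assms
proof induction
  case (linear g)
  \<comment> \<open>A real-linear functional on the plane is the real part of multiplication by a
    complex number, determined by its values at 1 and \<open>\<i>\<close>.\<close>
  have "g z = Re (poly [:0, of_real (g 1) - \<i> * of_real (g \<i>):] z)" for z
  proof -
    interpret bounded_linear g by fact
    have "g z = g (Re z *\<^sub>R 1 + Im z *\<^sub>R \<i>)"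
      by (metis complex_eq scaleR_conv_of_real mult.right_neutral mult.commute)
    then show ?thesis by (simp add: add scaleR)
  qed
  then show ?case by blast
next
  case (const c)
  show ?case by (intro exI[of _ "[:of_real c:]"]) auto
next
  case (add f g)
  then obtain p q where "\<forall>z. cmod z = 1 \<longrightarrow> f z = Re (poly p z)" "\<forall>z. cmod z = 1 \<longrightarrow> g z = Re (poly q z)"
    by blast
  then show ?case by (intro exI[of _ "p + q"]) auto
next
  case (mult f g)
  then obtain p q where pq: "\<forall>z. cmod z = 1 \<longrightarrow> f z = Re (poly p z)" "\<forall>z. cmod z = 1 \<longrightarrow> g z = Re (poly q z)"
    by blast
  obtain r where "\<forall>z. cmod z = 1 \<longrightarrow> Re (poly p z * cnj (poly q z)) = Re (poly r z)"
    using Re_poly_mult_cnj_poly by blast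
  then show ?case
    \<comment> \<open>This is 2 Re a Re b = Re (a b) + Re (a \<open>cnj\<close> b), where
      \<open>r\<close> represents the last term on the circle.\<close>
    using pq by (intro exI[of _ "smult (1/2) (p * q + r)"]) (auto simp: field_simps)
qed

section \<open>Poisson majorant of log^+ |f|\<close>

lemma log_plus_nonneg: "log_plus x \<ge> 0"
  by (simp add: log_plus_def)

lemma le_exp_log_plus: "x \<ge> 0 \<Longrightarrow> x \<le> exp (log_plus x)"
  by (cases "x = 0") (auto simp: log_plus_def max_def)

lemma log_plus_le: "x \<ge> 0 \<Longrightarrow> x \<le> exp y \<Longrightarrow> y \<ge> 0 \<Longrightarrow> log_plus x \<le> y"
  using ln_mono[of x "exp y"] by (cases "x = 0") (auto simp: log_plus_def)

lemma continuous_on_log_plus [continuous_intros]: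
  assumes "continuous_on A f" "\<And>x. x \<in> A \<Longrightarrow> f x \<ge> 0"
  shows "continuous_on A (\<lambda>x. log_plus (f x))"
proof -
  \<comment> \<open>Truncating below at 1 keeps \<open>ln\<close> away from its singularity at
    0.\<close>
  have "continuous_on A (\<lambda>x. ln (max 1 (f x)))"
    using assms by (intro continuous_intros) (auto simp: max_def)
  moreover have "ln (max 1 y) = log_plus y" if "y \<ge> 0" for y :: real
    using that by (cases "y = 0") (auto simp: log_plus_def max_def)
  ultimately show ?thesis
    using assms by (simp cong: continuous_on_cong)
qed

text \<open>Maximum modulus principle for f exp(-p), whose modulus is |f| / exp(Re p).\<close>

lemma norm_le_exp_Re_poly:
  assumes f: "continuous_on (cball 0 1) f" "f holomorphic_on ball 0 1"
    and le: "\<And>w. cmod w = 1 \<Longrightarrow> cmod (f w) \<le> exp (Re (poly p w))" and z: "cmod z \<le> 1"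
  shows "cmod (f z) \<le> exp (Re (poly p z))"
proof -
  have iff: "cmod (f w * exp (- poly p w)) \<le> 1 \<longleftrightarrow> cmod (f w) \<le> exp (Re (poly p w))" for w
  proof -
    have "cmod (f w * exp (- poly p w)) = cmod (f w) / exp (Re (poly p w))"
      by (simp add: norm_mult exp_minus norm_inverse divide_inverse)
    then show ?thesis by (simp only: pos_divide_le_eq[OF exp_gt_zero] mult_1)
  qed
  have "cmod (f z * exp (- poly p z)) \<le> 1"
  proof (rule maximum_modulus_frontier[where S = "cball 0 1" and f = "\<lambda>z. f z * exp (- poly p z)"])
    show "(\<lambda>z. f z * exp (- poly p z)) holomorphic_on interior (cball 0 1)"
      using f by (auto intro!: holomorphic_intros)
    show "continuous_on (closure (cball 0 1)) (\<lambda>z. f z * exp (- poly p z))"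
      using f by (auto intro!: continuous_intros)
    fix w :: complex assume "w \<in> frontier (cball 0 1)"
    then show "cmod (f w * exp (- poly p w)) \<le> 1"
      unfolding iff using le by (simp add: frontier_cball)
  qed (use z in auto)
  then show ?thesis by (simp only: iff)
qed

text \<open>Stone-Weierstrass gives a polynomial whose real part lies slightly above log^+ |f| on
  the circle. That real part dominates log^+ |f| inside the disc as well, and it equals its own
  Poisson integral.\<close>

lemma log_plus_le_poisson_integral:
  assumes f: "continuous_on (cball 0 1) f" "f holomorphic_on ball 0 1" and z: "cmod z < 1"
  shows "2 * pi * log_plus (cmod (f z)) \<le>
    integral {0..2 * pi} (\<lambda>t. poisson_kernel z (cis t) * log_plus (cmod (f (cis t))))"
proof (rule field_le_epsilon)
  fix \<epsilon> :: real assume "\<epsilon> > 0"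
  define e where "e = \<epsilon> / (4 * pi)"
  have "e > 0" using \<open>\<epsilon> > 0\<close> by (simp add: e_def)
  define u where "u w = log_plus (cmod (f w))" for w
  have u_cont: "continuous_on (sphere 0 1) u"
    unfolding u_def by (intro continuous_intros continuous_on_subset[OF f(1)]) auto
  \<comment> \<open>Approximating \<open>u + e\<close> rather than \<open>u\<close> places the
    approximant between \<open>u\<close> and \<open>u + 2 * e\<close>, so it is a majorant. The
    total error is \<open>2 * e\<close> times the kernel mass \<open>2 * pi\<close>, that is
    \<open>\<epsilon>\<close>.\<close>
  obtain g where g: "real_polynomial_function g" "\<And>w. w \<in> sphere 0 1 \<Longrightarrow> \<bar>(u w + e) - g w\<bar> < e"
  proof (rule Stone_Weierstrass_real_polynomial_function[of "sphere 0 1" "\<lambda>w. u w + e" e])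
    show "continuous_on (sphere 0 1) (\<lambda>w. u w + e)"
      by (intro continuous_intros u_cont)
  qed (use \<open>e > 0\<close> in auto)
  obtain p where "\<And>w. cmod w = 1 \<Longrightarrow> g w = Re (poly p w)"
    using real_polynomial_function_unit_circle[OF g(1)] by blast
  then have p: "u w \<le> Re (poly p w)" "Re (poly p w) \<le> u w + 2 * e" if "cmod w = 1" for w
    using g(2)[of w] that by (auto simp: abs_less_iff)
  have u_nonneg: "u w \<ge> 0" for w by (simp add: u_def log_plus_nonneg)
  have "cmod (f w) \<le> exp (Re (poly p w))" if "cmod w = 1" for w
    using le_exp_log_plus[of "cmod (f w)"] p(1)[OF that] unfolding u_def
    by (meson exp_le_cancel_iff norm_ge_zero order_trans)
  then have 1: "cmod (f z) \<le> exp (Re (poly p z))"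
    using norm_le_exp_Re_poly[OF f] z by simp
  \<comment> \<open>Comparison with the constant 1 shows that Re p is nonnegative in the disc, which
    upgrades the bound for log |f| to one for log^+ |f|.\<close>
  have "cmod ((\<lambda>_. 1) z :: complex) \<le> exp (Re (poly p z))"
    by (rule norm_le_exp_Re_poly) (use z p(1) u_nonneg in \<open>auto intro: order_trans\<close>)
  then have 2: "log_plus (cmod (f z)) \<le> Re (poly p z)"
    using 1 by (intro log_plus_le) auto
  let ?P = "\<lambda>t. poisson_kernel z (cis t)"
  have P1: "(?P has_integral 2 * pi) {0..2*pi}"
    using has_integral_Re[OF poisson_integral_holomorphic[of "\<lambda>_. 1" z]] z by simp
  have Pp: "((\<lambda>t. ?P t * Re (poly p (cis t))) has_integral 2 * pi * Re (poly p z)) {0..2*pi}"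
    using has_integral_Re[OF poisson_integral_holomorphic[of "poly p" z]] z
    by (simp add: holomorphic_intros)
  have "(\<lambda>t. ?P t * u (cis t)) integrable_on {0..2*pi}"
    by (intro integrable_continuous_real continuous_intros continuous_on_poisson_kernel z
        continuous_on_compose2[OF u_cont]) auto
  then have Pu: "((\<lambda>t. ?P t * u (cis t) + 2 * e * ?P t) has_integral
      integral {0..2*pi} (\<lambda>t. ?P t * u (cis t)) + 2 * e * (2 * pi)) {0..2*pi}"
    by (intro has_integral_add has_integral_mult_right P1) (rule integrable_integral)
  have "2 * pi * log_plus (cmod (f z)) \<le> 2 * pi * Re (poly p z)"
    using 2 by simp
  also have "\<dots> \<le> integral {0..2*pi} (\<lambda>t. ?P t * u (cis t)) + 2 * e * (2 * pi)"
  proof (rule has_integral_le[OF Pp Pu])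
    fix t
    have "?P t * Re (poly p (cis t)) \<le> ?P t * (u (cis t) + 2 * e)"
      using p(2) poisson_kernel_nonneg[OF z] by (intro mult_left_mono) auto
    then show "?P t * Re (poly p (cis t)) \<le> ?P t * u (cis t) + 2 * e * ?P t"
      by (simp add: algebra_simps)
  qed
  also have "2 * e * (2 * pi) = \<epsilon>" by (simp add: e_def)
  finally show "2 * pi * log_plus (cmod (f z)) \<le>
    integral {0..2 * pi} (\<lambda>t. poisson_kernel z (cis t) * log_plus (cmod (f (cis t)))) + \<epsilon>"
    by (simp add: u_def)
qed

section \<open>Sums over separated points near the circle\<close>

text \<open>At most one \<open>z i\<close> is within \<open>\<eta>\<close> of \<open>w\<close>; its
  term is at most 2 because \<open>1 - cmod (z i) \<le> cmod (w - z i)\<close>. Each other term is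
  at most 2 / K for K points, by the smallness hypothesis. Granting the slack 2 / K to every index
  gives 2 + 2.\<close>

lemma sum_poisson_kernel_separated_le:
  assumes "finite I" and "\<eta> > 0" and w: "cmod w = 1"
    and z: "\<And>i. i \<in> I \<Longrightarrow> cmod (z i) < 1"
    and sep: "\<And>i j. i \<in> I \<Longrightarrow> j \<in> I \<Longrightarrow> i \<noteq> j \<Longrightarrow> cmod (z i - z j) \<ge> 2 * \<eta>"
    and small: "\<And>i. i \<in> I \<Longrightarrow> (1 - cmod (z i))\<^sup>2 * real (card I) \<le> \<eta>\<^sup>2"
  shows "(\<Sum>i\<in>I. (1 - cmod (z i)) * poisson_kernel (z i) w) \<le> 4"
proof (cases "I = {}")
  case False
  define K where "K = real (card I)"
  have K: "K > 0" using False assms by (simp add: K_def card_gt_0_iff)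
  define A where "A = {i \<in> I. cmod (w - z i) < \<eta>}"
  have "i = j" if "i \<in> A" "j \<in> A" for i j
  proof (rule ccontr)
    assume "i \<noteq> j"
    then have "2 * \<eta> \<le> cmod (z i - z j)" using that sep by (auto simp: A_def)
    also have "\<dots> = cmod ((w - z j) - (w - z i))" by simp
    also have "\<dots> \<le> cmod (w - z j) + cmod (w - z i)" by (rule norm_triangle_ineq4)
    also have "\<dots> < 2 * \<eta>" using that by (auto simp: A_def)
    finally show False by simp
  qed
  then have "card A \<le> 1"
    using \<open>finite I\<close> by (auto simp: card_le_Suc0_iff_eq A_def)
  have term_le: "(1 - cmod (z i)) * poisson_kernel (z i) w \<le> (if i \<in> A then 2 else 0) + 2 / K" if i: "i \<in> I" for i
  proof -
    let ?d = "1 - cmod (z i)"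
    have d: "?d > 0" using z i by simp
    have dw: "?d \<le> cmod (w - z i)"
      using w norm_triangle_ineq2[of w "z i"] by simp
    then have pos: "cmod (w - z i) > 0" using d by linarith
    \<comment> \<open>From 1 - |z|^2 = (1 - |z|) (1 + |z|): the weight makes the numerator quadratic
      in the distance to the circle.\<close>
    have "?d * poisson_kernel (z i) w = (1 + cmod (z i)) * (?d\<^sup>2 / (cmod (w - z i))\<^sup>2)"
      by (simp add: poisson_kernel_def power2_eq_square algebra_simps)
    also have "\<dots> \<le> 2 * (?d\<^sup>2 / (cmod (w - z i))\<^sup>2)"
      using d by (intro mult_right_mono) auto
    finally have *: "?d * poisson_kernel (z i) w \<le> 2 * (?d\<^sup>2 / (cmod (w - z i))\<^sup>2)" .
    show ?thesis
    proof (cases "i \<in> A")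
      case True
      have "?d\<^sup>2 / (cmod (w - z i))\<^sup>2 \<le> 1"
        using dw d pos by (simp add: power_mono)
      moreover have "2 / K > 0" using K by simp
      ultimately have "?d * poisson_kernel (z i) w \<le> 2 + 2 / K" using * by linarith
      then show ?thesis using True by simp
    next
      case False
      then have "\<eta> \<le> cmod (w - z i)" using i by (auto simp: A_def)
      then have "?d\<^sup>2 / (cmod (w - z i))\<^sup>2 \<le> ?d\<^sup>2 / \<eta>\<^sup>2"
        using \<open>\<eta> > 0\<close> pos by (intro divide_left_mono power_mono) auto
      also have "\<dots> \<le> 1 / K"
        using small[OF i] K \<open>\<eta> > 0\<close> by (simp add: K_def field_simps)
      finally have "?d * poisson_kernel (z i) w \<le> 2 * (1 / K)" using * by linarith
      then show ?thesis using False by simp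
    qed
  qed
  have "(\<Sum>i\<in>I. (1 - cmod (z i)) * poisson_kernel (z i) w) \<le> (\<Sum>i\<in>I. (if i \<in> A then 2 else 0) + 2 / K)"
    by (intro sum_mono term_le)
  also have "\<dots> = 2 * real (card (I \<inter> A)) + 2"
    using \<open>finite I\<close> False by (simp add: sum.distrib K_def flip: sum.inter_restrict)
  also have "I \<inter> A = A" by (auto simp: A_def)
  also have "2 * real (card A) + 2 \<le> 4" using \<open>card A \<le> 1\<close> by simp
  finally show ?thesis .
qed auto

text \<open>Add the Poisson majorants at the individual points and bound the kernel sum by 4 under
  the integral; the number of points drops out.\<close>

lemma sum_log_plus_separated_le:
  assumes f: "continuous_on (cball 0 1) f" "f holomorphic_on ball 0 1"
    and "finite I" and "\<eta> > 0"
    and z: "\<And>i. i \<in> I \<Longrightarrow> cmod (z i) < 1"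
    and sep: "\<And>i j. i \<in> I \<Longrightarrow> j \<in> I \<Longrightarrow> i \<noteq> j \<Longrightarrow> cmod (z i - z j) \<ge> 2 * \<eta>"
    and small: "\<And>i. i \<in> I \<Longrightarrow> (1 - cmod (z i))\<^sup>2 * real (card I) \<le> \<eta>\<^sup>2"
  shows "(\<Sum>i\<in>I. (1 - cmod (z i)) * log_plus (cmod (f (z i)))) \<le>
    4 * (1 / (2 * pi) * integral {0..2 * pi} (\<lambda>t. log_plus (cmod (f (cis t)))))"
proof -
  let ?u = "\<lambda>t. log_plus (cmod (f (cis t)))"
  have u: "continuous_on {0..2*pi} ?u"
    by (intro continuous_intros continuous_on_compose2[OF f(1)]) auto
  have int: "(\<lambda>t. (1 - cmod (z i)) * (poisson_kernel (z i) (cis t) * ?u t)) integrable_on {0..2*pi}"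
    if "i \<in> I" for i
    using z[OF that] by (intro integrable_continuous_real continuous_intros u continuous_on_poisson_kernel)
  have "2 * pi * (\<Sum>i\<in>I. (1 - cmod (z i)) * log_plus (cmod (f (z i)))) =
     (\<Sum>i\<in>I. (1 - cmod (z i)) * (2 * pi * log_plus (cmod (f (z i)))))"
    unfolding sum_distrib_left by (intro sum.cong) (simp_all add: mult_ac)
  also have "\<dots> \<le> (\<Sum>i\<in>I. (1 - cmod (z i)) * integral {0..2*pi} (\<lambda>t. poisson_kernel (z i) (cis t) * ?u t))"
    using z by (intro sum_mono mult_left_mono log_plus_le_poisson_integral f) (auto simp: less_imp_le)
  also have "\<dots> = integral {0..2*pi} (\<lambda>t. \<Sum>i\<in>I. (1 - cmod (z i)) * (poisson_kernel (z i) (cis t) * ?u t))"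
    using \<open>finite I\<close> int by (simp add: integral_sum)
  also have "\<dots> \<le> integral {0..2*pi} (\<lambda>t. 4 * ?u t)"
  proof (rule integral_le)
    show "(\<lambda>t. \<Sum>i\<in>I. (1 - cmod (z i)) * (poisson_kernel (z i) (cis t) * ?u t)) integrable_on {0..2*pi}"
      using \<open>finite I\<close> int by (intro integrable_sum)
    show "(\<lambda>t. 4 * ?u t) integrable_on {0..2*pi}"
      by (intro integrable_continuous_real continuous_intros u)
    fix t
    have "(\<Sum>i\<in>I. (1 - cmod (z i)) * (poisson_kernel (z i) (cis t) * ?u t)) =
       (\<Sum>i\<in>I. (1 - cmod (z i)) * poisson_kernel (z i) (cis t)) * ?u t"
      unfolding sum_distrib_right by (intro sum.cong) (simp_all add: mult_ac)
    also have "\<dots> \<le> 4 * ?u t"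
      by (intro mult_right_mono sum_poisson_kernel_separated_le[where \<eta> = \<eta>] log_plus_nonneg assms) auto
    finally show "(\<Sum>i\<in>I. (1 - cmod (z i)) * (poisson_kernel (z i) (cis t) * ?u t)) \<le> 4 * ?u t" .
  qed
  finally show ?thesis
    by (simp add: field_simps)
qed

section \<open>Extremal growth and failure of interpolation\<close>

lemma finite_cluster_set_of_extremal_growth:
  assumes f: "f \<in> nevanlinna" and \<Lambda>: "\<Lambda> \<subseteq> ball 0 1"
    and growth: "\<And>z. z \<in> \<Lambda> \<Longrightarrow> 1 \<le> (1 - cmod z) * log_plus (cmod (f z))"
  shows "finite (sphere 0 1 \<inter> closure \<Lambda>)"
proof (rule ccontr)
  assume inf: "infinite (sphere 0 1 \<inter> closure \<Lambda>)"
  define mean where "mean \<rho> = 1 / (2 * pi) * integral {0..2 * pi} (\<lambda>t. log_plus (cmod (f (of_real \<rho> * cis t))))" for \<rho>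
  from f obtain L where hol: "f holomorphic_on ball 0 1" and L: "(mean \<longlongrightarrow> L) (at_left 1)"
    by (auto simp: nevanlinna_def mean_def[abs_def])
  \<comment> \<open>Each chosen point will contribute at least 1/2 to a sum below
    \<open>4 * (L + 1)\<close>, so more than \<open>8 * (L + 1)\<close> points are
    contradictory.\<close>
  define K where "K = nat \<lceil>8 * (L + 1)\<rceil> + 1"
  have K: "real K > 8 * (L + 1)" "real K \<ge> 1" by (auto simp: K_def) linarith
  obtain T where T: "finite T" "card T = K" "T \<subseteq> sphere 0 1 \<inter> closure \<Lambda>"
    using infinite_arbitrarily_large[OF inf] by blast
  obtain e where e: "e > 0" "\<And>x y. x \<in> T \<Longrightarrow> y \<in> T \<Longrightarrow> dist x y < e \<Longrightarrow> x = y"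
    using T(1) uniform_discrete_finite_iff[of T] unfolding uniform_discrete_def by blast
  \<comment> \<open>Points of \<open>T\<close> are at least \<open>4 * \<eta>\<close> apart; moving
    each by at most \<open>\<eta>\<close> leaves a separation of \<open>2 * \<eta>\<close>.\<close>
  define \<eta> where "\<eta> = e / 4"
  have \<eta>: "\<eta> > 0" using e by (simp add: \<eta>_def)
  \<comment> \<open>Closeness \<open>\<eta> / K\<close> also bounds the distance to the circle, and
    \<open>(\<eta> / K)\<^sup>2 * K \<le> \<eta>\<^sup>2\<close> is the smallness required of the
    points.\<close>
  have "\<exists>y\<in>\<Lambda>. dist y x < \<eta> / K" if "x \<in> T" for x
    using that T \<eta> K by (auto simp: closure_approachable)
  then obtain a where a: "\<And>x. x \<in> T \<Longrightarrow> a x \<in> \<Lambda>" "\<And>x. x \<in> T \<Longrightarrow> dist (a x) x < \<eta> / K"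
    by metis
  have less1: "cmod (a x) < 1" if "x \<in> T" for x using a(1)[OF that] \<Lambda> by auto
  have lim: "((\<lambda>\<rho>. 1 - cmod (a x) / \<rho>) \<longlongrightarrow> 1 - cmod (a x) / 1) (at_left 1)" for x
    by (intro tendsto_intros) auto
  \<comment> \<open>Rescaling the points by 1 / \<rho> pushes them towards the circle; for \<rho>
    near 1 the weights lose less than a factor 2, whence the lower bound 1/2 per point.\<close>
  have "\<forall>\<^sub>F \<rho> in at_left 1. \<forall>x\<in>T. 1 - cmod (a x) / \<rho> > (1 - cmod (a x)) / 2"
    using T(1) by (intro eventually_ball_finite ballI order_tendstoD(1)[OF lim]) (use less1 in auto)
  moreover have "\<forall>\<^sub>F \<rho> in at_left 1. mean \<rho> < L + 1"
    by (rule order_tendstoD[OF L]) auto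
  moreover have "\<forall>\<^sub>F \<rho> in at_left (1::real). \<rho> \<in> {0<..<1}"
    by (rule eventually_at_left_real) auto
  ultimately have "\<forall>\<^sub>F \<rho> in at_left 1. (\<forall>x\<in>T. 1 - cmod (a x) / \<rho> > (1 - cmod (a x)) / 2) \<and> mean \<rho> < L + 1 \<and> 0 < \<rho> \<and> \<rho> < 1"
    by eventually_elim auto
  then obtain \<rho> where \<rho>: "\<And>x. x \<in> T \<Longrightarrow> 1 - cmod (a x) / \<rho> > (1 - cmod (a x)) / 2" "mean \<rho> < L + 1" "0 < \<rho>" "\<rho> < 1"
    using eventually_happens trivial_limit_at_left_real by fast
  \<comment> \<open>\<open>f\<close> need not extend to the closed disc, hence the dilation by \<open>\<rho>\<close>.\<close>
  define g where "g z = f (of_real \<rho> * z)" for z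
  define z where "z x = a x / of_real \<rho>" for x
  have nz: "cmod (z x) = cmod (a x) / \<rho>" for x using \<rho> by (simp add: z_def norm_divide)
  \<comment> \<open>Division by \<rho> < 1 only enlarges moduli and mutual distances, so smallness
    and separation survive the rescaling.\<close>
  have dilate: "t \<le> t / \<rho>" if "t \<ge> 0" for t
    using mult_left_mono[of \<rho> 1 t] that \<rho>(3,4) by (simp add: pos_le_divide_eq)
  have div_K: "t / K \<le> t" if "t \<ge> 0" for t :: real
    using mult_left_mono[OF K(2) that] K(2) by (simp add: pos_divide_le_eq)
  have gz: "g (z x) = f (a x)" for x using \<rho> by (simp add: g_def z_def)
  have sub: "(\<lambda>z :: complex. of_real \<rho> * z) ` cball 0 1 \<subseteq> ball 0 1"
  proof (rule image_subsetI)
    fix w :: complex assume "w \<in> cball 0 1"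
    then have "\<rho> * cmod w \<le> \<rho> * 1" using \<rho>(3) by (intro mult_left_mono) auto
    then have "\<rho> * cmod w < 1" using \<rho>(4) by linarith
    then show "of_real \<rho> * w \<in> ball 0 1" using \<rho>(3) by (simp add: norm_mult)
  qed
  have ghol: "g holomorphic_on cball 0 1"
    unfolding g_def by (rule holomorphic_on_compose_gen[OF _ hol sub, unfolded o_def]) (intro holomorphic_intros)
  have "(\<Sum>x\<in>T. (1 - cmod (z x)) * log_plus (cmod (g (z x)))) \<le>
    4 * (1 / (2 * pi) * integral {0..2 * pi} (\<lambda>t. log_plus (cmod (g (cis t)))))"
  proof (rule sum_log_plus_separated_le[where f = g and z = z and \<eta> = \<eta>])
    show "continuous_on (cball 0 1) g" "g holomorphic_on ball 0 1"
      using ghol by (auto intro: holomorphic_on_imp_continuous_on holomorphic_on_subset)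
    show "finite T" "\<eta> > 0" by fact+
    fix x assume x: "x \<in> T"
    show z1: "cmod (z x) < 1"
      using less_trans[OF _ \<rho>(1)[OF x], of 0] less1[OF x] unfolding nz by simp
    have "cmod (a x) \<le> cmod (z x)" unfolding nz by (intro dilate) simp
    moreover have "1 - cmod (a x) \<le> dist (a x) x"
      using x T norm_triangle_ineq2[of x "a x"] by (auto simp: dist_norm norm_minus_commute)
    ultimately have "1 - cmod (z x) \<le> \<eta> / K" using a(2)[OF x] by linarith
    then have "(1 - cmod (z x))\<^sup>2 * K \<le> (\<eta> / K)\<^sup>2 * K"
      using z1 by (intro mult_right_mono power_mono) auto
    also have "\<dots> = \<eta>\<^sup>2 / K" by (simp add: power2_eq_square)
    also have "\<dots> \<le> \<eta>\<^sup>2" by (intro div_K) simp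
    finally show "(1 - cmod (z x))\<^sup>2 * real (card T) \<le> \<eta>\<^sup>2" using T by simp
    fix y assume y: "y \<in> T" and "x \<noteq> y"
    then have "dist x y \<ge> 4 * \<eta>" using e(2)[OF x y] by (force simp: \<eta>_def)
    moreover have "dist x y \<le> dist (a x) x + dist (a x) (a y) + dist (a y) y"
      by metric
    moreover have "\<eta> / K \<le> \<eta>" using \<eta> by (intro div_K) simp
    ultimately have "2 * \<eta> \<le> cmod (a x - a y)"
      using a(2)[OF x] a(2)[OF y] unfolding dist_norm[of "a x" "a y"] by linarith
    also have "\<dots> \<le> cmod (a x - a y) / \<rho>" by (intro dilate) simp
    also have "\<dots> = cmod (z x - z y)"
      using \<rho> by (simp add: z_def norm_divide flip: diff_divide_distrib)
    finally show "2 * \<eta> \<le> cmod (z x - z y)" .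
  qed
  also have "\<dots> = 4 * mean \<rho>" by (simp add: g_def mean_def)
  also have "\<dots> < 4 * (L + 1)" using \<rho> by simp
  finally have "(\<Sum>x\<in>T. (1 - cmod (z x)) * log_plus (cmod (g (z x)))) < 4 * (L + 1)" .
  moreover have "(\<Sum>x\<in>T. 1 / 2) \<le> (\<Sum>x\<in>T. (1 - cmod (z x)) * log_plus (cmod (g (z x))))"
  proof (rule sum_mono)
    fix x assume x: "x \<in> T"
    have "(1 - cmod (a x)) / 2 * log_plus (cmod (f (a x))) \<le> (1 - cmod (z x)) * log_plus (cmod (f (a x)))"
      using \<rho>(1)[OF x] unfolding nz by (intro mult_right_mono log_plus_nonneg) auto
    then show "1 / 2 \<le> (1 - cmod (z x)) * log_plus (cmod (g (z x)))"
      using growth[OF a(1)[OF x]] unfolding gz by simp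
  qed
  ultimately show False using K T by simp
qed

lemma not_naftalevic_interpolating:
  assumes \<Lambda>: "\<Lambda> \<subseteq> ball 0 1" and inf: "infinite (sphere 0 1 \<inter> closure \<Lambda>)"
  shows "\<not> naftalevic_interpolating \<Lambda>"
proof
  assume naf: "naftalevic_interpolating \<Lambda>"
  \<comment> \<open>These values are extremal among admissible data: the weighted log^+ is
    identically 1 on \<Lambda>.\<close>
  define a where "a = restrict (\<lambda>z. of_real (exp (1 / (1 - cmod z))) :: complex) \<Lambda>"
  have a: "(1 - cmod z) * log_plus (cmod (a z)) = 1" if "z \<in> \<Lambda>" for z
  proof -
    have "cmod z < 1" using that \<Lambda> by auto
    then show ?thesis using that by (simp add: a_def log_plus_def)
  qed
  have "a \<in> extensional \<Lambda>" by (simp add: a_def)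
  moreover have "bdd_above ((\<lambda>z. (1 - cmod z) * log_plus (cmod (a z))) ` \<Lambda>)"
    using a by (intro bdd_aboveI2[of _ _ 1]) auto
  ultimately have "a \<in> nevanlinna_trace \<Lambda>"
    using naf by (simp add: naftalevic_interpolating_def)
  then obtain f where f: "f \<in> nevanlinna" "a = restrict f \<Lambda>"
    by (auto simp: nevanlinna_trace_def)
  have "1 \<le> (1 - cmod z) * log_plus (cmod (f z))" if "z \<in> \<Lambda>" for z
    using a[OF that] f(2) that by simp
  from finite_cluster_set_of_extremal_growth[OF f(1) \<Lambda> this] inf show False by simp
qed

section \<open>Random arguments and almost sure clustering\<close>

text \<open>A case of the second Borel-Cantelli lemma: by independence, missing \<open>A\<close> at
  all times from \<open>k\<close> to \<open>k + m\<close> has probability at most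
  \<open>(1 - p) ^ Suc m\<close>, which tends to 0.\<close>

lemma (in prob_space) AE_indep_vars_infinitely_often:
  fixes X :: "nat \<Rightarrow> 'a \<Rightarrow> 'b"
  assumes X: "indep_vars (\<lambda>_. N) X UNIV" and A: "A \<in> sets N" and "p > 0"
    and p: "\<And>n. prob (X n -` A \<inter> space M) \<ge> p"
  shows "AE \<omega> in M. \<forall>k. \<exists>n\<ge>k. X n \<omega> \<in> A"
  unfolding AE_all_countable
proof
  fix k
  have rv[measurable]: "random_variable N (X n)" for n
    using X by (auto simp: indep_vars_def)
  note A[measurable]
  define B where "B = {\<omega> \<in> space M. \<forall>n\<ge>k. X n \<omega> \<notin> A}"
  have B[measurable]: "B \<in> events" unfolding B_def by measurable
  have "p \<le> 1" using p[of 0] prob_le_1 order_trans by blast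
  have le: "prob B \<le> (1 - p) ^ Suc m" for m
  proof -
    have "prob B \<le> prob (\<Inter>i\<in>{k..k+m}. X i -` (space N - A) \<inter> space M)"
    proof (rule finite_measure_mono)
      show "B \<subseteq> (\<Inter>i\<in>{k..k+m}. X i -` (space N - A) \<inter> space M)"
        using measurable_space[OF rv] by (auto simp: B_def)
    qed measurable
    also have "\<dots> = (\<Prod>i\<in>{k..k+m}. prob (X i -` (space N - A) \<inter> space M))"
      using A by (intro indep_varsD[OF X]) auto
    also have "\<dots> \<le> (\<Prod>i\<in>{k..k+m}. 1 - p)"
    proof (rule prod_mono)
      fix i
      have "X i -` (space N - A) \<inter> space M = space M - (X i -` A \<inter> space M)"
        using measurable_space[OF rv] by auto
      then have "prob (X i -` (space N - A) \<inter> space M) = 1 - prob (X i -` A \<inter> space M)"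
        by (simp add: prob_compl)
      then show "0 \<le> prob (X i -` (space N - A) \<inter> space M) \<and> prob (X i -` (space N - A) \<inter> space M) \<le> 1 - p"
        using p[of i] by simp
    qed
    finally show ?thesis by simp
  qed
  have "(\<lambda>m. (1 - p) ^ Suc m) \<longlonglongrightarrow> 0"
    using \<open>p > 0\<close> \<open>p \<le> 1\<close> by (intro LIMSEQ_Suc LIMSEQ_power_zero) auto
  then have "prob B \<le> 0"
    by (rule LIMSEQ_le_const) (use le in auto)
  then have "B \<in> null_sets M"
    using B measure_nonneg[of M B] by (intro null_setsI) (auto simp: emeasure_eq_measure)
  then show "AE \<omega> in M. \<exists>n\<ge>k. X n \<omega> \<in> A"
    by (rule AE_I') (auto simp: B_def)
qed

lemma norm_cis_diff_le: "cmod (cis a - cis b) \<le> \<bar>a - b\<bar>"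
proof -
  have "cis a - cis b = cis b * (cis (a - b) - 1)"
    by (simp add: algebra_simps cis_mult)
  then have "cmod (cis a - cis b) = cmod (cis (a - b) - 1)"
    by (simp add: norm_mult)
  also have "\<dots> = 2 * \<bar>sin ((a - b) / 2)\<bar>"
    unfolding cis_conv_exp by (rule dist_exp_i_1)
  also have "\<dots> \<le> \<bar>a - b\<bar>"
    using abs_sin_x_le_abs_x[of "(a - b) / 2"] by simp
  finally show ?thesis .
qed

theorem proposition3p9:
  fixes M :: "'a measure" and r :: "nat \<Rightarrow> real" and \<theta> :: "nat \<Rightarrow> 'a \<Rightarrow> real"
  assumes "prob_space M"
    and "\<And>n. 0 \<le> r n \<and> r n < 1"
    and "summable (\<lambda>n. 1 - r n)"
    and "prob_space.indep_vars M (\<lambda>_. borel) \<theta> UNIV"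
    and "\<And>n. distr M borel (\<theta> n) = uniform_measure lborel {0..<2 * pi}"
  shows "{\<omega> \<in> space M. naftalevic_interpolating (range (\<lambda>n. of_real (r n) * cis (\<theta> n \<omega>)))}
           \<in> null_sets (completion M)"
proof -
  interpret prob_space M by fact
  let ?\<Lambda> = "\<lambda>\<omega>. range (\<lambda>n. of_real (r n) * cis (\<theta> n \<omega>))"
  have rv[measurable]: "\<theta> n \<in> borel_measurable M" for n
    using assms(4) by (auto simp: indep_vars_def)
  \<comment> \<open>An arc of length \<epsilon> inside \<open>{0..<2 * pi}\<close> has the same
    probability \<open>\<epsilon> / (2 * pi)\<close> for every \<open>n\<close>.\<close>
  have hit: "AE \<omega> in M. \<forall>k. \<exists>n\<ge>k. \<theta> n \<omega> \<in> {q..<q + \<epsilon>}" if q: "0 \<le> q" "\<epsilon> > 0" "q + \<epsilon> \<le> 2 * pi" for q \<epsilon>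
  proof (rule AE_indep_vars_infinitely_often[OF assms(4), where p = "\<epsilon> / (2 * pi)"])
    fix n
    have "prob (\<theta> n -` {q..<q + \<epsilon>} \<inter> space M) = measure (distr M borel (\<theta> n)) {q..<q + \<epsilon>}"
      by (simp add: measure_distr)
    also have "\<dots> = measure lborel ({0..<2 * pi} \<inter> {q..<q + \<epsilon>}) / measure lborel {0..<2 * pi}"
      unfolding assms(5) by (rule measure_uniform_measure) auto
    also have "{0..<2 * pi} \<inter> {q..<q + \<epsilon>} = {q..<q + \<epsilon>}" using q by auto
    finally show "\<epsilon> / (2 * pi) \<le> prob (\<theta> n -` {q..<q + \<epsilon>} \<inter> space M)" using q by simp
  qed (use q in auto)
  \<comment> \<open>The sequence serves twice: \<open>q j\<close> as angles of infinitely many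
    distinct cluster points, \<open>q m\<close> as lengths of shrinking arcs. Countability lets the
    almost sure statements be combined.\<close>
  define q where "q j = 1 / real (Suc j)" for j
  have q: "0 < q j" "q j \<le> 1" for j by (auto simp: q_def)
  have q2: "q j + q m \<le> 2 * pi" for j m using q[of j] q[of m] pi_gt3 by linarith
  have "AE \<omega> in M. \<forall>j m k. \<exists>n\<ge>k. \<theta> n \<omega> \<in> {q j..<q j + q m}"
    using hit[OF less_imp_le[OF q(1)] q(1) q2] unfolding AE_all_countable by simp
  moreover have "\<not> naftalevic_interpolating (?\<Lambda> \<omega>)"
    if \<omega>: "\<forall>j m k. \<exists>n\<ge>k. \<theta> n \<omega> \<in> {q j..<q j + q m}" for \<omega>
  proof (rule not_naftalevic_interpolating)
    show "?\<Lambda> \<omega> \<subseteq> ball 0 1" using assms(2) by (auto simp: norm_mult)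
    have "cis (q j) \<in> closure (?\<Lambda> \<omega>)" for j
      unfolding closure_approachable
    proof (intro allI impI)
      fix e :: real assume "e > 0"
      then obtain m where m: "q m < e / 2"
        using reals_Archimedean[of "e / 2"] by (auto simp: q_def inverse_eq_divide)
      \<comment> \<open>The radii tend to 1, so a sufficiently late visit to the arc is also
        radially close to the circle.\<close>
      have "(\<lambda>n. 1 - r n) \<longlonglongrightarrow> 0" using assms(3) by (rule summable_LIMSEQ_zero)
      then have "\<forall>\<^sub>F n in sequentially. 1 - r n < e / 2"
        using \<open>e > 0\<close> by (intro order_tendstoD) auto
      then obtain k where k: "\<And>n. n \<ge> k \<Longrightarrow> 1 - r n < e / 2"
        by (auto simp: eventually_sequentially)
      obtain n where n: "n \<ge> k" "\<theta> n \<omega> \<in> {q j..<q j + q m}" using \<omega> by blast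
      let ?z = "of_real (r n) * cis (\<theta> n \<omega>)"
      have "dist ?z (cis (q j)) \<le> dist ?z (cis (\<theta> n \<omega>)) + dist (cis (\<theta> n \<omega>)) (cis (q j))"
        by (rule dist_triangle)
      also have "dist ?z (cis (\<theta> n \<omega>)) = cmod (of_real (r n - 1) * cis (\<theta> n \<omega>))"
        by (simp add: dist_norm algebra_simps)
      also have "\<dots> = 1 - r n" using assms(2)[of n] by (simp only: norm_mult norm_of_real) simp
      also have "\<dots> < e / 2" using k n by simp
      also have "dist (cis (\<theta> n \<omega>)) (cis (q j)) \<le> q m"
        using norm_cis_diff_le[of "\<theta> n \<omega>" "q j"] n by (auto simp: dist_norm)
      finally have "dist ?z (cis (q j)) < e" using m by simp
      then show "\<exists>y\<in>?\<Lambda> \<omega>. dist y (cis (q j)) < e" by blast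
    qed
    then have "range (\<lambda>j. cis (q j)) \<subseteq> sphere 0 1 \<inter> closure (?\<Lambda> \<omega>)" by auto
    moreover have "inj (\<lambda>j. cis (q j))"
    proof (rule injI)
      fix i j assume "cis (q i) = cis (q j)"
      \<comment> \<open>The angles lie in (0, 1], inside the interval [0, \<pi>] on which cosine is
        injective.\<close>
      then have "cos (q i) = cos (q j)" by (metis cis.sel(1))
      then have "q i = q j"
        using q[of i] q[of j] pi_gt3 cos_inj_pi[of "q i" "q j"] by auto
      then show "i = j" by (simp add: q_def)
    qed
    ultimately show "infinite (sphere 0 1 \<inter> closure (?\<Lambda> \<omega>))"
      using finite_subset range_inj_infinite by blast
  qed
  ultimately have "AE \<omega> in M. \<not> naftalevic_interpolating (?\<Lambda> \<omega>)" by (rule eventually_mono)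
  \<comment> \<open>Measurability of the event is not established; it is enclosed in a null set of
    \<open>M\<close>, which makes it null in the completion.\<close>
  then obtain N where "N \<in> null_sets M" "{\<omega> \<in> space M. \<not> \<not> naftalevic_interpolating (?\<Lambda> \<omega>)} \<subseteq> N"
    unfolding eventually_ae_filter by blast
  then show ?thesis
    unfolding null_sets_completion_iff2 by auto
qed

end
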